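(* Let $\mathfrak{g}$ be a finite-dimensional complex non-abelian Lie algebra. Then the direct product Lie algebra $\mathfrak{g}\oplus\mathfrak{g}$ and the semi-direct product Lie algebra $\mathfrak{g}\rtimes\mathfrak{g}$ are not isomorphic.
   Context: The direct product $\mathfrak{g}\oplus\mathfrak{g}$ has the bracket $[(m,g),(m',g')]=([m,m'],[g,g'])$. The semi-direct product $\mathfrak{g}\rtimes\mathfrak{g}$ is the vector space $\mathfrak{g}\oplus\mathfrak{g}$ with bracket $[(m,g),(m',g')]=([g,m']-[g',m],[g,g'])$; that is, the first factor is viewed as the adjoint $\mathfrak{g}$-module and as an abelian Lie algebra. *)

theory Defs
  imports "HOL-Analysis.Analysis"
begin

text \<open>
  The underlying space of a Lie algebra is a whole type, as in the library locale
  \<^locale>\<open>vector_space\<close>. No Lie bracket is built into the type, so the product type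
  \<open>'b \<times> 'b\<close> can carry both the direct and the semi-direct product bracket.
\<close>

locale lie_algebra = vector_space scale
  for scale :: "'a::field \<Rightarrow> 'b::ab_group_add \<Rightarrow> 'b" +
  fixes bracket :: "'b \<Rightarrow> 'b \<Rightarrow> 'b"
  assumes bracket_add_left: "bracket (x + y) z = bracket x z + bracket y z"
    and bracket_add_right: "bracket x (y + z) = bracket x y + bracket x z"
    and bracket_scale_left: "bracket (scale c x) y = scale c (bracket x y)"
    and bracket_scale_right: "bracket x (scale c y) = scale c (bracket x y)"
    and bracket_self: "bracket x x = 0"
    and jacobi: "bracket x (bracket y z) + bracket y (bracket z x) + bracket z (bracket x y) = 0"

definition lie_abelian :: "('b::ab_group_add \<Rightarrow> 'b \<Rightarrow> 'b) \<Rightarrow> bool"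
  where "lie_abelian br \<longleftrightarrow> (\<forall>x y. br x y = 0)"

definition lie_isomorphism ::
  "('a::field \<Rightarrow> 'b::ab_group_add \<Rightarrow> 'b) \<Rightarrow> ('b \<Rightarrow> 'b \<Rightarrow> 'b) \<Rightarrow>
   ('a \<Rightarrow> 'c::ab_group_add \<Rightarrow> 'c) \<Rightarrow> ('c \<Rightarrow> 'c \<Rightarrow> 'c) \<Rightarrow> ('b \<Rightarrow> 'c) \<Rightarrow> bool"
  where "lie_isomorphism s1 br1 s2 br2 f \<longleftrightarrow>
    Vector_Spaces.linear s1 s2 f \<and> bij f \<and> (\<forall>x y. f (br1 x y) = br2 (f x) (f y))"

definition lie_isomorphic ::
  "('a::field \<Rightarrow> 'b::ab_group_add \<Rightarrow> 'b) \<Rightarrow> ('b \<Rightarrow> 'b \<Rightarrow> 'b) \<Rightarrow>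
   ('a \<Rightarrow> 'c::ab_group_add \<Rightarrow> 'c) \<Rightarrow> ('c \<Rightarrow> 'c \<Rightarrow> 'c) \<Rightarrow> bool"
  where "lie_isomorphic s1 br1 s2 br2 \<longleftrightarrow> (\<exists>f. lie_isomorphism s1 br1 s2 br2 f)"

definition direct_bracket ::
  "('b::ab_group_add \<Rightarrow> 'b \<Rightarrow> 'b) \<Rightarrow> 'b \<times> 'b \<Rightarrow> 'b \<times> 'b \<Rightarrow> 'b \<times> 'b"
  where "direct_bracket br = (\<lambda>(m, g) (m', g'). (br m m', br g g'))"

text \<open>
  In a pair \<open>(m, g)\<close> the first component lies in the adjoint module, which is an abelian ideal,
  and the second in the acting Lie algebra.
\<close>

definition semidirect_bracket ::
  "('b::ab_group_add \<Rightarrow> 'b \<Rightarrow> 'b) \<Rightarrow> 'b \<times> 'b \<Rightarrow> 'b \<times> 'b \<Rightarrow> 'b \<times> 'b"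
  where "semidirect_bracket br = (\<lambda>(m, g) (m', g'). (br g m' - br g' m, br g g'))"

context lie_algebra
begin

lemma bracket_anticomm: "bracket x y = - bracket y x"
proof -
  have "bracket x y + bracket y x = bracket (x + y) (x + y)"
    unfolding bracket_add_left bracket_add_right by (simp add: bracket_self)
  also have "\<dots> = 0"
    by (rule bracket_self)
  finally have "bracket x y + bracket y x = 0" .
  then show ?thesis
    by (simp only: eq_neg_iff_add_eq_0)
qed

lemma bracket_diff_right: "bracket x (y - z) = bracket x y - bracket x z"
  using bracket_add_right[of x "y - z" z] by simp

lemma jacobi_ad: "bracket (bracket x y) z = bracket x (bracket y z) - bracket y (bracket x z)"
proof -
  have "bracket y (bracket z x) = - bracket y (bracket x z)"
    using bracket_add_right[of y "bracket z x" "bracket x z"]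
      bracket_diff_right[of y "bracket x z" "bracket x z"]
    by (metis add.right_inverse bracket_anticomm diff_self eq_neg_iff_add_eq_0)
  moreover have "bracket z (bracket x y) = - bracket (bracket x y) z"
    by (rule bracket_anticomm)
  ultimately show ?thesis
    using jacobi[of x y z] by (simp add: algebra_simps)
qed

lemma vector_space_prod_self: "vector_space_prod scale scale"
  by unfold_locales

lemma lie_algebra_direct:
  "lie_algebra (module_prod.scale scale scale) (direct_bracket bracket)"
proof -
  interpret P: vector_space_prod scale scale
    by (rule vector_space_prod_self)
  show ?thesis
    by unfold_locales
      (auto simp: direct_bracket_def P.scale_def bracket_add_left bracket_add_right
        bracket_scale_left bracket_scale_right bracket_self jacobi[unfolded add.assoc] add.assoc zero_prod_def split_beta)
qed

lemma lie_algebra_semidirect: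
  "lie_algebra (module_prod.scale scale scale) (semidirect_bracket bracket)"
proof -
  interpret P: vector_space_prod scale scale
    by (rule vector_space_prod_self)
  show ?thesis
    by unfold_locales
      (auto simp: semidirect_bracket_def P.scale_def bracket_add_left bracket_add_right
        bracket_scale_left bracket_scale_right bracket_self jacobi[unfolded add.assoc] jacobi_ad bracket_diff_right
        scale_right_diff_distrib zero_prod_def split_beta algebra_simps)
qed

end

end

theory Submission
  imports Defs "HOL-Library.Function_Algebras"
begin

text \<open>
  The two Lie algebras are told apart by the dimension of their derivation algebras. Let \<open>D\<close>
  be the space of derivations of \<open>\<gg>\<close>, \<open>C\<close> its centroid (the linear
  endomorphisms that commute with all \<open>ad x\<close>), and \<open>H \<subseteq> C\<close> the space of linear maps that
  kill all brackets and take values in the centre.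

  On \<open>\<gg> \<oplus> \<gg>\<close> a derivation is a \<open>2 \<times> 2\<close> block matrix. Its diagonal blocks lie in
  \<open>D\<close>, and since the two factors commute its off-diagonal blocks lie in \<open>H\<close>
  (lemma \<open>direct_derivations_subset\<close>). On \<open>\<gg> \<rtimes> \<gg>\<close> any two derivations \<open>d\<^sub>1, d\<^sub>2\<close> of
  \<open>\<gg>\<close>, any \<open>c\<close> in \<open>C\<close> and any \<open>h\<close> in \<open>H\<close> give the derivation
  \<open>(m, g) \<mapsto> (d\<^sub>1 m + c m + d\<^sub>2 g, d\<^sub>1 g + h m)\<close> (lemma \<open>rearrange_derivation\<close>): here
  \<open>c\<close> is an endomorphism of the adjoint module and \<open>d\<^sub>2\<close> is a cocycle with values in the adjoint module.
  So the dimensions are at most \<open>2 dim D + 2 dim H\<close> on one side and at least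
  \<open>2 dim D + dim C + dim H\<close> on the other. If \<open>\<gg>\<close> is not abelian, then the identity lies in
  \<open>C\<close> and not in \<open>H\<close>, so \<open>dim H < dim C\<close>.

  The comparison needs no explicit dimensions. An isomorphism \<open>f\<close> would carry derivations of
  \<open>\<gg> \<rtimes> \<gg>\<close> back to derivations of \<open>\<gg> \<oplus> \<gg>\<close> by conjugation. Composed with the
  assignment above, this is an injective linear map from the space of block matrices over
  \<open>D, C, H, D\<close> into its proper subspace of derivations of \<open>\<gg> \<oplus> \<gg>\<close>, which is
  impossible in finite dimension. The argument works over every field.
\<close>

section \<open>Finite-dimensional spaces of endomorphisms\<close>

text \<open>
  A basis of \<open>U\<close> together with one vector of \<open>V - U\<close> is independent, and its image would be
  an independent subset of \<open>U\<close> with more elements than the basis.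
\<close>

lemma (in vector_space) no_linear_injection_into_proper_subspace:
  assumes "finite A" "U \<subseteq> span A" "subspace U" "subspace V" "U \<subset> V"
    and f: "Vector_Spaces.linear scale scale f" "inj_on f V" "f ` V \<subseteq> U"
  shows False
proof -
  obtain b where b: "b \<subseteq> U" "independent b" "U \<subseteq> span b"
    using maximal_independent_subset by blast
  have fin: "finite b"
    using independent_span_bound[OF \<open>finite A\<close> b(2)] b(1) assms(2) by blast
  have "span b = U"
    using span_subspace b \<open>subspace U\<close> by blast
  obtain v where v: "v \<in> V" "v \<notin> U"
    using \<open>U \<subset> V\<close> by blast
  let ?b = "insert v b"
  have "independent ?b"
    using b(2) v(2) \<open>span b = U\<close> by (simp add: independent_insertI)
  have span_V: "span ?b \<subseteq> V"
    using v(1) b(1) \<open>U \<subset> V\<close> \<open>subspace V\<close> by (intro span_minimal) auto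
  interpret f: Vector_Spaces.linear scale scale f by (rule f(1))
  have inj: "inj_on f (span ?b)"
    using f(2) span_V by (rule inj_on_subset)
  have "independent (f ` ?b)"
    by (rule f.independent_injective_image[OF \<open>independent ?b\<close> inj])
  moreover have "f ` ?b \<subseteq> span b"
    using f(3) v(1) b(1) \<open>U \<subset> V\<close> \<open>span b = U\<close> by auto
  ultimately have "card (f ` ?b) \<le> card b"
    using independent_span_bound[OF fin] by blast
  moreover have "card (f ` ?b) = card ?b"
    using inj span_superset by (intro card_image) (rule inj_on_subset)
  moreover have "card ?b = Suc (card b)"
    using fin v(2) b(1) by (intro card_insert_disjoint) auto
  ultimately show False
    by simp
qed

text \<open>
  The scalar action on the space of maps into a vector space; addition of maps is the pointwise
  addition of \<^theory>\<open>HOL-Library.Function_Algebras\<close>.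
\<close>

definition fun_scale :: "('a \<Rightarrow> 'b \<Rightarrow> 'b) \<Rightarrow> 'a \<Rightarrow> ('c \<Rightarrow> 'b) \<Rightarrow> 'c \<Rightarrow> 'b"
  where "fun_scale s c F = (\<lambda>x. s c (F x))"

lemma fun_scale_apply [simp]: "fun_scale s c F x = s c (F x)"
  by (simp add: fun_scale_def)

lemma (in vector_space) vector_space_fun_scale: "vector_space (fun_scale scale)"
  by unfold_locales (simp_all add: fun_eq_iff algebra_simps)

lemma sum_fun_apply: "(\<Sum>a\<in>A. f a) x = (\<Sum>a\<in>A. f a x :: 'b::comm_monoid_add)"
  by (induction A rule: infinite_finite_induct) simp_all

lemma (in finite_dimensional_vector_space) endomorphisms_finitely_spanned:
  obtains A where "finite A"
    and "{F. Vector_Spaces.linear scale scale F} \<subseteq> module.span (fun_scale scale) A"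
proof -
  interpret E: vector_space "fun_scale scale :: 'a \<Rightarrow> ('b \<Rightarrow> 'b) \<Rightarrow> 'b \<Rightarrow> 'b"
    by (rule vector_space_fun_scale)
  let ?r = "representation Basis"
  \<comment> \<open>The matrix unit that sends \<open>b\<close> to \<open>c\<close> and every other basis vector to \<open>0\<close>.\<close>
  define e where "e b c = (\<lambda>x. scale (?r x b) c)" for b c
  let ?A = "(\<lambda>(b, c). e b c) ` (Basis \<times> Basis)"
  have expand: "(\<Sum>b\<in>Basis. scale (?r x b) b) = x" for x
    using sum_representation_eq[of Basis x Basis] independent_Basis finite_Basis span_Basis by simp
  have "F \<in> E.span ?A" if "Vector_Spaces.linear scale scale F" for F
  proof -
    interpret F: Vector_Spaces.linear scale scale F by (rule that)
    have "F x = (\<Sum>b\<in>Basis. \<Sum>c\<in>Basis. fun_scale scale (?r (F b) c) (e b c) x)" for x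
    proof -
      have "F x = F (\<Sum>b\<in>Basis. scale (?r x b) b)"
        by (simp add: expand)
      also have "\<dots> = (\<Sum>b\<in>Basis. scale (?r x b) (F b))"
        by (simp add: F.sum F.scale)
      also have "\<dots> = (\<Sum>b\<in>Basis. scale (?r x b) (\<Sum>c\<in>Basis. scale (?r (F b) c) c))"
        by (simp add: expand)
      also have "\<dots> = (\<Sum>b\<in>Basis. \<Sum>c\<in>Basis. fun_scale scale (?r (F b) c) (e b c) x)"
        by (simp add: e_def scale_sum_right mult.commute)
      finally show ?thesis .
    qed
    then have "F = (\<Sum>b\<in>Basis. \<Sum>c\<in>Basis. fun_scale scale (?r (F b) c) (e b c))"
      unfolding fun_eq_iff sum_fun_apply by blast
    also have "\<dots> \<in> E.span ?A"
      by (intro E.span_sum E.span_scale E.span_base) auto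
    finally show ?thesis .
  qed
  moreover have "finite ?A"
    using finite_Basis by simp
  ultimately show thesis
    using that by blast
qed

section \<open>Derivations and the centroid\<close>

definition derivations ::
  "('a::field \<Rightarrow> 'b::ab_group_add \<Rightarrow> 'b) \<Rightarrow> ('b \<Rightarrow> 'b \<Rightarrow> 'b) \<Rightarrow> ('b \<Rightarrow> 'b) set"
  where "derivations s br = {D. Vector_Spaces.linear s s D \<and>
    (\<forall>x y. D (br x y) = br (D x) y + br x (D y))}"

definition centroid ::
  "('a::field \<Rightarrow> 'b::ab_group_add \<Rightarrow> 'b) \<Rightarrow> ('b \<Rightarrow> 'b \<Rightarrow> 'b) \<Rightarrow> ('b \<Rightarrow> 'b) set"
  where "centroid s br = {c. Vector_Spaces.linear s s c \<and> (\<forall>x y. c (br x y) = br x (c y))}"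

text \<open>
  These maps are the linear maps from the abelianization \<open>\<gg> / [\<gg>, \<gg>]\<close> to the centre.
\<close>

definition central_maps ::
  "('a::field \<Rightarrow> 'b::ab_group_add \<Rightarrow> 'b) \<Rightarrow> ('b \<Rightarrow> 'b \<Rightarrow> 'b) \<Rightarrow> ('b \<Rightarrow> 'b) set"
  where "central_maps s br = {h. Vector_Spaces.linear s s h \<and>
    (\<forall>x y. h (br x y) = 0 \<and> br x (h y) = 0)}"

lemma derivation_conjugate:
  assumes f: "lie_isomorphism s1 br1 s2 br2 f" and D: "D \<in> derivations s2 br2"
  shows "inv f \<circ> D \<circ> f \<in> derivations s1 br1"
proof -
  have lin: "Vector_Spaces.linear s1 s2 f" and "bij f"
    and br: "f (br1 x y) = br2 (f x) (f y)" for x y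
    using f by (auto simp: lie_isomorphism_def)
  interpret f: Vector_Spaces.linear s1 s2 f by (rule lin)
  have [simp]: "f (inv f z) = z" for z
    using \<open>bij f\<close> by (simp add: bij_is_surj surj_f_inv_f)
  have eqI: "x = y" if "f x = f y" for x y
    using that \<open>bij f\<close> by (simp add: bij_is_inj inj_eq)
  show ?thesis
    using D unfolding derivations_def
    by (auto simp: Vector_Spaces.linear_iff f.add f.scale br f.vs1.vector_space_axioms intro!: eqI)
qed

section \<open>Derivations of the direct and the semi-direct product\<close>

context lie_algebra
begin

abbreviation pscale :: "'a \<Rightarrow> 'b \<times> 'b \<Rightarrow> 'b \<times> 'b"
  where "pscale \<equiv> module_prod.scale scale scale"

lemma pscale_Pair: "pscale c (x, y) = (scale c x, scale c y)"
proof -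
  interpret P: vector_space_prod scale scale
    by (rule vector_space_prod_self)
  show ?thesis by (rule P.scale_prod)
qed

lemma bracket_zero_left [simp]: "bracket 0 x = 0"
  using bracket_add_left[of 0 0 x] by simp

lemma bracket_zero_right [simp]: "bracket x 0 = 0"
  using bracket_add_right[of x 0 0] by simp

lemma central_left: "bracket z x = 0" if "\<And>x. bracket x z = 0"
  using that bracket_anticomm[of z x] by simp

text \<open>
  The block matrices that contain every derivation of the direct product, with the condition on
  the upper right block relaxed from central maps to the centroid. Every such
  matrix still yields a derivation of the semi-direct product, by \<open>rearrange\<close> below.
\<close>

definition block_space :: "('b \<times> 'b \<Rightarrow> 'b \<times> 'b) set"
  where "block_space = {F. Vector_Spaces.linear pscale pscale F \<and>
    (\<lambda>x. fst (F (x, 0))) \<in> derivations scale bracket \<and>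
    (\<lambda>y. fst (F (0, y))) \<in> centroid scale bracket \<and>
    (\<lambda>x. snd (F (x, 0))) \<in> central_maps scale bracket \<and>
    (\<lambda>y. snd (F (0, y))) \<in> derivations scale bracket}"

text \<open>
  With \<open>F = (d\<^sub>1, c; h, d\<^sub>2)\<close> in block form, this is the matrix \<open>(d\<^sub>1 + c, d\<^sub>2; h, d\<^sub>1)\<close>.
  A derivation of \<open>\<gg>\<close> acts on the semi-direct product diagonally, and also by mapping the
  acting algebra to the module; the blocks \<open>d\<^sub>1\<close> and \<open>d\<^sub>2\<close> take these two roles.
\<close>

definition rearrange :: "('b \<times> 'b \<Rightarrow> 'b \<times> 'b) \<Rightarrow> 'b \<times> 'b \<Rightarrow> 'b \<times> 'b"
  where "rearrange F = (\<lambda>(m, g).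
    (fst (F (m, 0)) + fst (F (0, m)) + snd (F (0, g)), fst (F (g, 0)) + snd (F (m, 0))))"

lemma vector_space_pscale: "vector_space pscale"
proof -
  interpret P: lie_algebra pscale "direct_bracket bracket"
    by (rule lie_algebra_direct)
  show ?thesis ..
qed

lemma vector_space_endomorphisms: "vector_space (fun_scale pscale)"
  by (rule vector_space.vector_space_fun_scale) (rule vector_space_pscale)

lemma linear_pscale_iff:
  "Vector_Spaces.linear pscale pscale F \<longleftrightarrow>
    (\<forall>x y. F (x + y) = F x + F y) \<and> (\<forall>c x. F (pscale c x) = pscale c (F x))"
  by (simp add: Vector_Spaces.linear_iff vector_space_pscale)

lemma linear_scale_iff:
  "Vector_Spaces.linear scale scale F \<longleftrightarrow>
    (\<forall>x y. F (x + y) = F x + F y) \<and> (\<forall>c x. F (scale c x) = scale c (F x))"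
  by (simp add: Vector_Spaces.linear_iff vector_space_axioms)

lemma linear_blocks:
  assumes "Vector_Spaces.linear pscale pscale F"
  shows "Vector_Spaces.linear scale scale (\<lambda>x. fst (F (x, 0)))"
    and "Vector_Spaces.linear scale scale (\<lambda>y. fst (F (0, y)))"
    and "Vector_Spaces.linear scale scale (\<lambda>x. snd (F (x, 0)))"
    and "Vector_Spaces.linear scale scale (\<lambda>y. snd (F (0, y)))"
proof -
  have add: "F (x + x', y + y') = F (x, y) + F (x', y')"
    and sc: "F (scale c x, scale c y) = pscale c (F (x, y))" for x x' y y' c
    using assms unfolding linear_pscale_iff
    by (metis add_Pair, metis pscale_Pair)
  have [simp]: "fst (pscale c p) = scale c (fst p)" "snd (pscale c p) = scale c (snd p)" for c p
    by (cases p, simp add: pscale_Pair)+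
  show "Vector_Spaces.linear scale scale (\<lambda>x. fst (F (x, 0)))"
    "Vector_Spaces.linear scale scale (\<lambda>y. fst (F (0, y)))"
    "Vector_Spaces.linear scale scale (\<lambda>x. snd (F (x, 0)))"
    "Vector_Spaces.linear scale scale (\<lambda>y. snd (F (0, y)))"
    using add[of _ _ 0 0] add[of 0 0] sc[of _ _ 0] sc[of _ 0]
    by (simp_all add: linear_scale_iff)
qed

lemma linear_eq_blocks:
  assumes "Vector_Spaces.linear pscale pscale F"
  shows "F (x, y) = F (x, 0) + F (0, y)"
  using assms unfolding linear_pscale_iff by (metis add_Pair add_0 add_0_right)

lemma direct_derivations_subset: "derivations pscale (direct_bracket bracket) \<subseteq> block_space"
proof
  fix F
  assume F: "F \<in> derivations pscale (direct_bracket bracket)"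
  then have lin: "Vector_Spaces.linear pscale pscale F"
    and leib: "F (bracket x x', bracket y y') =
      direct_bracket bracket (F (x, y)) (x', y') + direct_bracket bracket (x, y) (F (x', y'))"
    for x y x' y'
    by (auto simp: derivations_def) (metis direct_bracket_def case_prod_conv)
  note db = direct_bracket_def split_beta
  \<comment> \<open>The two factors commute, so applying \<open>F\<close> to \<open>[(x, 0), (0, y)] = 0\<close> shows
    that the off-diagonal blocks are central.\<close>
  have off: "bracket x (fst (F (0, y))) = 0 \<and> bracket (snd (F (x, 0))) y = 0" for x y
    using leib[of x 0 0 y] linear_eq_blocks[OF lin, of 0 0]
    by (simp add: db prod_eq_iff)
  have D1: "F (bracket x x', 0) = (bracket (fst (F (x, 0))) x' + bracket x (fst (F (x', 0))), 0)" for x x'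
    using leib[of x x' 0 0] by (simp add: db)
  have D2: "F (0, bracket y y') = (0, bracket (snd (F (0, y))) y' + bracket y (snd (F (0, y'))))" for y y'
    using leib[of 0 0 y y'] by (simp add: db)
  have "bracket y (snd (F (x, 0))) = 0" for x y
    using off[of x y] bracket_anticomm[of y] by simp
  then show "F \<in> block_space"
    using off lin linear_blocks[OF lin]
    by (auto simp: block_space_def derivations_def centroid_def central_maps_def D1 D2)
qed

text \<open>
  The strictness comes from the identity, which is in the centroid but kills all brackets only
  if the algebra is abelian. Placed in the upper right block, it is no derivation.
\<close>

lemma block_space_proper:
  assumes "\<not> lie_abelian bracket"
  shows "derivations pscale (direct_bracket bracket) \<subset> block_space"
proof -
  obtain x y where xy: "bracket x y \<noteq> 0"
    using assms by (auto simp: lie_abelian_def)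
  define F :: "'b \<times> 'b \<Rightarrow> 'b \<times> 'b" where "F = (\<lambda>(x, y). (y, 0))"
  have "Vector_Spaces.linear pscale pscale F"
    by (auto simp: linear_pscale_iff F_def pscale_Pair)
  then have "F \<in> block_space"
    by (auto simp: block_space_def F_def derivations_def centroid_def central_maps_def linear_scale_iff)
  moreover have "F \<notin> derivations pscale (direct_bracket bracket)"
  proof
    assume "F \<in> derivations pscale (direct_bracket bracket)"
    then have "F (direct_bracket bracket (x, 0) (0, y)) =
        direct_bracket bracket (F (x, 0)) (0, y) + direct_bracket bracket (x, 0) (F (0, y))"
      unfolding derivations_def by blast
    then show False
      using xy by (simp add: F_def direct_bracket_def)
  qed
  ultimately show ?thesis
    using direct_derivations_subset by blast
qed

text \<open>
  The Leibniz rule holds block by block. In the module component, \<open>d\<^sub>1 + c\<close> acts on the module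
  and \<open>d\<^sub>1\<close> on the acting algebra; the difference \<open>c\<close> is harmless because it commutes with the
  adjoint action. The block \<open>h\<close> contributes nothing because it kills brackets and has central
  values.
\<close>

lemma rearrange_derivation:
  assumes "F \<in> block_space"
  shows "rearrange F \<in> derivations pscale (semidirect_bracket bracket)"
proof -
  define d1 where "d1 x = fst (F (x, 0))" for x
  define c where "c y = fst (F (0, y))" for y
  define h where "h x = snd (F (x, 0))" for x
  define d2 where "d2 y = snd (F (0, y))" for y
  have d1: "d1 \<in> derivations scale bracket" and d2: "d2 \<in> derivations scale bracket"
    and c: "c \<in> centroid scale bracket" and h: "h \<in> central_maps scale bracket"
    using assms unfolding block_space_def d1_def[abs_def] d2_def[abs_def] c_def[abs_def] h_def[abs_def]
    by auto
  have R: "rearrange F (m, g) = (d1 m + c m + d2 g, d1 g + h m)" for m g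
    by (simp add: rearrange_def d1_def d2_def c_def h_def)
  have add: "d1 (x + y) = d1 x + d1 y" "d2 (x + y) = d2 x + d2 y" "c (x + y) = c x + c y"
      "h (x + y) = h x + h y"
    and sc: "d1 (scale k x) = scale k (d1 x)" "d2 (scale k x) = scale k (d2 x)"
      "c (scale k x) = scale k (c x)" "h (scale k x) = scale k (h x)"
    and br: "d1 (bracket x y) = bracket (d1 x) y + bracket x (d1 y)"
      "d2 (bracket x y) = bracket (d2 x) y + bracket x (d2 y)"
      "c (bracket x y) = bracket x (c y)" "h (bracket x y) = 0" "bracket x (h y) = 0" for k x y
    using d1 d2 c h
    by (auto simp: derivations_def centroid_def central_maps_def linear_scale_iff)
  have hl: "bracket (h x) y = 0" for x y
    using br(5) central_left by blast
  have diff: "d1 (x - y) = d1 x - d1 y" "d2 (x - y) = d2 x - d2 y" "c (x - y) = c x - c y"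
      "h (x - y) = h x - h y" for x y
    using add(1)[of "x - y" y] add(2)[of "x - y" y] add(3)[of "x - y" y] add(4)[of "x - y" y]
    by simp_all
  have "Vector_Spaces.linear pscale pscale (rearrange F)"
    by (auto simp: linear_pscale_iff R pscale_Pair add sc algebra_simps)
  moreover have "rearrange F (semidirect_bracket bracket p q) =
      semidirect_bracket bracket (rearrange F p) q + semidirect_bracket bracket p (rearrange F q)" for p q
  proof -
    obtain m g m' g' where [simp]: "p = (m, g)" "q = (m', g')" by (cases p, cases q)
    \<comment> \<open>The module component of the bracket contains \<open>- [g', d\<^sub>2 g]\<close>, the Leibniz rule for
      \<open>d\<^sub>2\<close> contains \<open>[d\<^sub>2 g, g']\<close>.\<close>
    have "bracket (d2 g) g' = - bracket g' (d2 g)"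
      by (rule bracket_anticomm)
    then show ?thesis
      by (simp add: R semidirect_bracket_def diff br hl bracket_add_left bracket_add_right)
  qed
  ultimately show ?thesis
    by (simp add: derivations_def)
qed

text \<open>
  Evaluation at \<open>(0, g)\<close> recovers \<open>d\<^sub>2\<close> and \<open>d\<^sub>1\<close>, and then evaluation at \<open>(g, 0)\<close>
  recovers \<open>c\<close> and \<open>h\<close>.
\<close>

lemma inj_on_rearrange: "inj_on rearrange block_space"
proof (rule inj_onI)
  fix F G
  assume F: "F \<in> block_space" and G: "G \<in> block_space" and eq: "rearrange F = rearrange G"
  have z: "F (0, 0) = 0" "G (0, 0) = 0"
    using F G linear_eq_blocks[of _ 0 0] by (auto simp: block_space_def)
  have eq': "rearrange F (m, g) = rearrange G (m, g)" for m g
    using eq by simp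
  have "snd (F (0, g)) = snd (G (0, g))" "fst (F (g, 0)) = fst (G (g, 0))"
    "snd (F (g, 0)) = snd (G (g, 0))" "fst (F (0, g)) = fst (G (0, g))" for g
    using eq'[of 0 g] eq'[of g 0] z by (simp_all add: rearrange_def)
  then have "F (x, 0) = G (x, 0)" "F (0, y) = G (0, y)" for x y
    by (simp_all add: prod_eq_iff)
  then have "F (x, y) = G (x, y)" for x y
    using F G linear_eq_blocks[of F x y] linear_eq_blocks[of G x y] by (simp add: block_space_def)
  then show "F = G"
    by (simp add: fun_eq_iff)
qed

lemma subspace_derivations: "module.subspace (fun_scale scale) (derivations scale bracket)"
proof -
  interpret E: vector_space "fun_scale scale :: 'a \<Rightarrow> ('b \<Rightarrow> 'b) \<Rightarrow> 'b \<Rightarrow> 'b"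
    by (rule vector_space_fun_scale)
  show ?thesis
    by (auto simp: E.subspace_def derivations_def linear_scale_iff bracket_add_left
        bracket_add_right bracket_scale_left bracket_scale_right algebra_simps)
qed

lemma subspace_block_space: "module.subspace (fun_scale pscale) block_space"
proof -
  interpret W: vector_space pscale
    by (rule vector_space_pscale)
  interpret E: vector_space "fun_scale pscale :: 'a \<Rightarrow> ('b \<times> 'b \<Rightarrow> 'b \<times> 'b) \<Rightarrow> _"
    by (rule vector_space_endomorphisms)
  have [simp]: "fst (pscale c p) = scale c (fst p)" "snd (pscale c p) = scale c (snd p)" for c p
    by (cases p, simp add: pscale_Pair)+
  show ?thesis
    by (auto simp: E.subspace_def block_space_def derivations_def centroid_def central_maps_def
        linear_scale_iff linear_pscale_iff bracket_add_left
        bracket_add_right bracket_scale_left bracket_scale_right scale_right_distrib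
        W.scale_right_distrib add_ac mult.commute)
qed

section \<open>Comparison of the two products\<close>

theorem direct_not_isomorphic_semidirect:
  assumes fin: "finite_dimensional_vector_space scale B" and nonab: "\<not> lie_abelian bracket"
  shows "\<not> lie_isomorphic pscale (direct_bracket bracket) pscale (semidirect_bracket bracket)"
proof
  assume "lie_isomorphic pscale (direct_bracket bracket) pscale (semidirect_bracket bracket)"
  then obtain f where f: "lie_isomorphism pscale (direct_bracket bracket) pscale (semidirect_bracket bracket) f"
    by (auto simp: lie_isomorphic_def)
  interpret finite_dimensional_vector_space scale B by (rule fin)
  interpret P: finite_dimensional_vector_space_prod scale scale B B ..
  interpret L: lie_algebra pscale "direct_bracket bracket"
    by (rule lie_algebra_direct)
  interpret E: vector_space "fun_scale pscale :: 'a \<Rightarrow> ('b \<times> 'b \<Rightarrow> 'b \<times> 'b) \<Rightarrow> _"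
    by (rule vector_space_endomorphisms)
  have lin: "Vector_Spaces.linear pscale pscale f" and "bij f"
    using f by (auto simp: lie_isomorphism_def)
  have [simp]: "f (inv f z) = z" "inv f (f z) = z" for z
    using \<open>bij f\<close> by (simp_all add: bij_is_surj surj_f_inv_f bij_is_inj)
  have inv_add: "inv f (x + y) = inv f x + inv f y" for x y
    using lin \<open>bij f\<close> by (intro inv_f_eq) (simp_all add: linear_pscale_iff bij_is_inj del: split_paired_All)
  have inv_scale: "inv f (pscale c x) = pscale c (inv f x)" for c x
    using lin \<open>bij f\<close> by (intro inv_f_eq) (simp_all add: linear_pscale_iff bij_is_inj del: split_paired_All)
  define \<Phi> where "\<Phi> F = inv f \<circ> rearrange F \<circ> f" for F
  obtain A where A: "finite A"
    "{F. Vector_Spaces.linear pscale pscale F} \<subseteq> module.span (fun_scale pscale) A"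
    using P.p.endomorphisms_finitely_spanned .
  show False
  proof (rule E.no_linear_injection_into_proper_subspace[OF A(1)])
    show "derivations pscale (direct_bracket bracket) \<subseteq> E.span A"
      using A(2) by (auto simp: derivations_def)
    show "Vector_Spaces.linear (fun_scale pscale) (fun_scale pscale) \<Phi>"
      unfolding Vector_Spaces.linear_iff
    proof (intro conjI allI vector_space_endomorphisms)
      fix F G c
      have "rearrange (F + G) p = rearrange F p + rearrange G p" for p
        by (cases p) (simp add: rearrange_def algebra_simps)
      then show "\<Phi> (F + G) = \<Phi> F + \<Phi> G"
        by (simp add: \<Phi>_def fun_eq_iff inv_add)
      have "rearrange (fun_scale pscale c F) p = pscale c (rearrange F p)" for p
        by (cases p) (simp add: rearrange_def P.scale_def scale_right_distrib)
      then show "\<Phi> (fun_scale pscale c F) = fun_scale pscale c (\<Phi> F)"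
        by (simp add: \<Phi>_def fun_eq_iff inv_scale)
    qed
    have conj: "f \<circ> \<Phi> F \<circ> inv f = rearrange F" for F
      by (simp add: \<Phi>_def fun_eq_iff)
    show "inj_on \<Phi> block_space"
      by (rule inj_onI) (metis conj inj_on_rearrange inj_onD)
    show "\<Phi> ` block_space \<subseteq> derivations pscale (direct_bracket bracket)"
      using derivation_conjugate[OF f rearrange_derivation] by (auto simp: \<Phi>_def)
  qed (rule L.subspace_derivations subspace_block_space block_space_proper nonab)+
qed

end

theorem corollary2p6:
  fixes scale :: "complex \<Rightarrow> 'g::ab_group_add \<Rightarrow> 'g"
    and B :: "'g set"
    and bracket :: "'g \<Rightarrow> 'g \<Rightarrow> 'g"
  assumes "finite_dimensional_vector_space scale B"
    and "lie_algebra scale bracket"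
    and "\<not> lie_abelian bracket"
  shows "\<not> lie_isomorphic
    (module_prod.scale scale scale) (direct_bracket bracket)
    (module_prod.scale scale scale) (semidirect_bracket bracket)"
  using lie_algebra.direct_not_isomorphic_semidirect[OF assms(2,1,3)] .

end
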